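(* Let $\lambda>0$ and $\mathbf{Y}\in\mathbb{R}^{m\times n}$. For any $p\in[1,\infty]$ one has that $$\min_{\mathbf{X}\in\mathbb{R}^{m\times n}} \max_{\boldsymbol\Delta\in\mathcal{U}_{(\sigma_p,F_2)}} \|\mathbf{Y}-\mathbf{X}-\boldsymbol\Delta(\mathbf{X})\|_{F_2} = \min_{\mathbf{X}\in\mathbb{R}^{m\times n}} \left[\|\mathbf{Y}-\mathbf{X}\|_{F_2} + \lambda \|\mathbf{X}\|_{\sigma_p}\right]$$ and $$\min_{\mathbf{X}\in\mathbb{R}^{m\times n}} \max_{\boldsymbol\Delta\in\mathcal{U}_{(\sigma_p,\sigma_\infty)}} \|\mathbf{Y}-\mathbf{X}-\boldsymbol\Delta(\mathbf{X})\|_{\sigma_\infty} = \min_{\mathbf{X}\in\mathbb{R}^{m\times n}} \left[\|\mathbf{Y}-\mathbf{X}\|_{\sigma_\infty} + \lambda \|\mathbf{X}\|_{\sigma_p}\right].$$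
   Context: $\|\cdot\|_{F_2}$ is the Frobenius norm, $\|\cdot\|_{\sigma_p}$ is the Schatten norm ($\ell_p$ norm of the vector of singular values), and $\|\cdot\|_{\sigma_\infty}$ is the operator norm (largest singular value). For norms $h,g$ on $\mathbb{R}^{m\times n}$, $$\mathcal{U}_{(h,g)}:=\{\boldsymbol\Delta:\mathbb{R}^{m\times n}\to\mathbb{R}^{m\times n}\ |\ \boldsymbol\Delta\text{ linear},\ g(\boldsymbol\Delta(\mathbf{X}))\le\lambda h(\mathbf{X})\ \forall\,\mathbf{X}\in\mathbb{R}^{m\times n}\},$$ and $\mathcal{U}_{(\sigma_p,F_2)}$, $\mathcal{U}_{(\sigma_p,\sigma_\infty)}$ denote this set with $h=\|\cdot\|_{\sigma_p}$ and $g=\|\cdot\|_{F_2}$, respectively $g=\|\cdot\|_{\sigma_\infty}$. *)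

theory Defs
  imports "HOL-Analysis.Analysis" "HOL-Library.Multiset"
begin

definition eigenspace :: "real^'n^'n \<Rightarrow> real \<Rightarrow> (real^'n) set" where
  "eigenspace B e = {v. B *v v = e *\<^sub>R v}"

text \<open>The multiplicity of an eigenvalue is taken to be the dimension of its eigenspace. The
  definition is only applied to symmetric matrices, for which this is also the algebraic
  multiplicity, and for which the multiset has exactly \<open>CARD('n)\<close> elements.\<close>

definition eigenvalues :: "real^'n^'n \<Rightarrow> real multiset" where
  "eigenvalues B =
     (\<Sum>e\<in>{e. \<exists>v. v \<noteq> 0 \<and> B *v v = e *\<^sub>R v}. replicate_mset (dim (eigenspace B e)) e)"

text \<open>For an \<open>m \<times> n\<close> matrix this multiset has \<open>n\<close> elements. If \<open>m < n\<close>, it consists of the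
  \<open>min m n\<close> singular values and \<open>n - m\<close> additional zeros, which change neither
  an \<open>\<ell>\<^sub>p\<close> norm nor the largest singular value.\<close>

definition singular_values :: "real^'n^'m \<Rightarrow> real multiset" where
  "singular_values A = image_mset sqrt (eigenvalues (transpose A ** A))"

definition lp_norm :: "ereal \<Rightarrow> real multiset \<Rightarrow> real" where
  "lp_norm p M =
     (if p = \<infinity> then Max (abs ` set_mset M)
      else (\<Sum>x\<in>#M. \<bar>x\<bar> powr real_of_ereal p) powr (1 / real_of_ereal p))"

text \<open>In particular, \<open>schatten_norm \<infinity>\<close> is the largest singular value.\<close>

definition schatten_norm :: "ereal \<Rightarrow> real^'n^'m \<Rightarrow> real" where
  "schatten_norm p A = lp_norm p (singular_values A)"

definition frobenius_norm :: "real^'n^'m \<Rightarrow> real" where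
  "frobenius_norm A = sqrt (\<Sum>i\<in>UNIV. \<Sum>j\<in>UNIV. (A $ i $ j)\<^sup>2)"

definition uncertainty_set ::
  "real \<Rightarrow> (real^'n^'m \<Rightarrow> real) \<Rightarrow> (real^'n^'m \<Rightarrow> real) \<Rightarrow> (real^'n^'m \<Rightarrow> real^'n^'m) set" where
  "uncertainty_set lam h g = {\<Delta>. linear \<Delta> \<and> (\<forall>X. g (\<Delta> X) \<le> lam * h X)}"

text \<open>Maxima and minima are attained values, not merely suprema and infima.\<close>

definition is_max_on :: "('a \<Rightarrow> real) \<Rightarrow> 'a set \<Rightarrow> real \<Rightarrow> bool" where
  "is_max_on f S v \<longleftrightarrow> (\<exists>x\<in>S. f x = v) \<and> (\<forall>x\<in>S. f x \<le> v)"

definition is_min_on :: "('a \<Rightarrow> real) \<Rightarrow> 'a set \<Rightarrow> real \<Rightarrow> bool" where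
  "is_min_on f S v \<longleftrightarrow> (\<exists>x\<in>S. f x = v) \<and> (\<forall>x\<in>S. v \<le> f x)"

end

theory Submission imports Defs begin

text \<open>For a linear \<open>\<phi> \<le> h\<close> with \<open>\<phi> X = h X\<close> and \<open>Z\<close> of \<open>g\<close>-norm 1 in the direction of \<open>Y - X\<close>,
  the map \<open>W \<mapsto> - lam * \<phi> W * Z\<close> lies in the uncertainty set and turns the triangle inequality
  \<open>g (Y - X - \<Delta> X) \<le> g (Y - X) + lam * h X\<close> into an equality, so both minimised functions coincide.
  They are convex, hence continuous, and coercive. For a Schatten norm, \<open>\<phi>\<close> is read off a singular value
  decomposition of \<open>X\<close>. For finite \<open>p\<close>, the bound \<open>\<phi> W \<le> h W\<close> holds because the products
  \<open>\<bar>u i \<bullet> w j\<bar> * \<bar>v i \<bullet> z j\<bar>\<close> of inner products of the singular vectors of \<open>X\<close> and \<open>W\<close> form a doubly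
  substochastic matrix; for \<open>p = \<infinity>\<close>, \<open>h\<close> is the operator norm. The convexity of \<open>h\<close> follows from
  the existence of \<open>\<phi>\<close> at every point.\<close>

section \<open>Spectral theorem for self-adjoint maps\<close>

text \<open>A maximiser \<open>v\<close> of the quadratic form \<open>x \<bullet> T x\<close> on the
  unit sphere of \<open>S\<close> is an eigenvector: the residual \<open>w = T v - e v\<close> lies
  in \<open>S\<close> and is orthogonal to \<open>v\<close>, and moving from \<open>v\<close> along
  \<open>w\<close> would increase the Rayleigh quotient unless \<open>w = 0\<close>.\<close>

lemma selfadjoint_eigenvector_in_subspace:
  fixes T :: "'a::euclidean_space \<Rightarrow> 'a"
  assumes "linear T" and sym: "\<And>x y. T x \<bullet> y = x \<bullet> T y"
    and S: "subspace S" "S \<noteq> {0}" and inv: "T ` S \<subseteq> S"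
  obtains v e where "v \<in> S" "norm v = 1" "T v = e *\<^sub>R v"
proof -
  interpret linear T by fact
  define K where "K = S \<inter> sphere 0 1"
  obtain x0 where x0: "x0 \<in> S" "x0 \<noteq> 0"
    using S subspace_0 by blast
  have "compact K"
    unfolding K_def using S by (intro closed_Int_compact closed_subspace) auto
  moreover have "x0 /\<^sub>R norm x0 \<in> K"
    unfolding K_def using x0 S by (simp add: subspace_scale)
  moreover have "continuous_on K (\<lambda>x. x \<bullet> T x)"
    using \<open>linear T\<close> by (intro continuous_intros linear_continuous_on linear_linear[THEN iffD2])
  ultimately obtain v where v: "v \<in> K" and vmax: "\<And>x. x \<in> K \<Longrightarrow> x \<bullet> T x \<le> v \<bullet> T v"
    by (metis continuous_attains_sup empty_iff)
  define e where "e = v \<bullet> T v"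
  have vS: "v \<in> S" and nv: "norm v = 1"
    using v by (auto simp: K_def)
  have vv: "v \<bullet> v = 1"
    using nv by (simp add: norm_eq_1)
  have le: "x \<bullet> T x \<le> e * (x \<bullet> x)" if "x \<in> S" for x
  proof (cases "x = 0")
    case False
    have "x /\<^sub>R norm x \<in> K"
      unfolding K_def using that False S by (simp add: subspace_scale)
    from vmax[OF this] have "(x \<bullet> T x) / (norm x)^2 \<le> e"
      by (simp add: e_def scale power2_eq_square divide_inverse ac_simps)
    then show ?thesis
      using False by (simp add: divide_le_eq power2_norm_eq_inner)
  qed simp
  define w where "w = T v - e *\<^sub>R v"
  have wS: "w \<in> S"
    unfolding w_def using vS inv S by (intro subspace_diff subspace_scale) auto
  have wv: "w \<bullet> v = 0"
    by (simp add: w_def inner_diff_left vv e_def inner_commute[of "T v"])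
  have wT: "w \<bullet> T v = w \<bullet> w"
    using wv by (simp add: w_def inner_diff_right inner_diff_left algebra_simps)
  define k where "k = e * (w \<bullet> w) - w \<bullet> T w"
  \<comment> \<open>The maximality bound at \<open>v + t w\<close>: the gain is linear in
    \<open>t\<close> with coefficient \<open>2 * (w \<bullet> w)\<close>, the loss is only
    quadratic.\<close>
  have ineq: "2 * t * (w \<bullet> w) \<le> t^2 * k" for t
  proof -
    have "v + t *\<^sub>R w \<in> S"
      using vS wS S by (intro subspace_add subspace_scale)
    from le[OF this] have "(v + t *\<^sub>R w) \<bullet> T (v + t *\<^sub>R w) \<le> e * ((v + t *\<^sub>R w) \<bullet> (v + t *\<^sub>R w))" .
    moreover have "v \<bullet> T w = w \<bullet> w"
      using wT sym[of v w] by (simp add: inner_commute)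
    ultimately have "e + 2 * t * (w \<bullet> w) + t^2 * (w \<bullet> T w) \<le> e * (1 + t^2 * (w \<bullet> w))"
      using wT wv vv
      by (simp add: add scale inner_add_left inner_add_right e_def[symmetric] power2_eq_square
          inner_commute[of v w] algebra_simps)
    then show ?thesis
      by (simp add: k_def algebra_simps)
  qed
  \<comment> \<open>For \<open>k > 0\<close> the value \<open>t = (w \<bullet> w) / k\<close> makes
    the right side of \<open>ineq\<close> half of the left one, which forces both to vanish. For
    \<open>k \<le> 0\<close> already \<open>t = 1\<close> suffices.\<close>
  have "w \<bullet> w \<le> 0"
  proof (cases "k > 0")
    case True
    have "2 * ((w \<bullet> w) * (w \<bullet> w)) \<le> (w \<bullet> w) * (w \<bullet> w)"
      using ineq[of "(w \<bullet> w) / k"] True by (simp add: power2_eq_square field_simps)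
    then have "(w \<bullet> w) * (w \<bullet> w) \<le> 0" by simp
    then show ?thesis by (metis mult_eq_0_iff order_refl zero_le_square order_antisym)
  next
    case False
    then show ?thesis using ineq[of 1] by simp
  qed
  then have "w = 0"
    by (metis inner_gt_zero_iff not_le)
  then have "T v = e *\<^sub>R v"
    by (simp add: w_def)
  then show ?thesis using that vS nv by blast
qed

text \<open>Induction on the dimension: after a unit eigenvector \<open>v\<close> is split off, its
  orthogonal complement within \<open>S\<close> is again invariant, because
  \<open>v \<bullet> T x = T v \<bullet> x\<close> is a multiple of
  \<open>v \<bullet> x\<close>.\<close>

lemma selfadjoint_orthonormal_eigenbasis_subspace:
  fixes T :: "'a::euclidean_space \<Rightarrow> 'a"
  assumes "linear T" and sym: "\<And>x y. T x \<bullet> y = x \<bullet> T y"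
    and "subspace S" "T ` S \<subseteq> S"
  shows "\<exists>B. B \<subseteq> S \<and> finite B \<and> pairwise orthogonal B \<and> (\<forall>v\<in>B. norm v = 1) \<and> span B = S
    \<and> (\<forall>v\<in>B. \<exists>e. T v = e *\<^sub>R v)"
  using assms(3,4)
proof (induction "dim S" arbitrary: S rule: less_induct)
  case less
  show ?case
  proof (cases "S = {0}")
    case True
    then show ?thesis by (intro exI[of _ "{}"]) auto
  next
    case False
    obtain v e where v: "v \<in> S" "norm v = 1" "T v = e *\<^sub>R v"
      using selfadjoint_eigenvector_in_subspace[OF assms(1,2) less.prems(1) False less.prems(2)]
      by blast
    define S' where "S' = S \<inter> {x. v \<bullet> x = 0}"
    have sub': "subspace S'"
      unfolding S'_def by (intro subspace_inter less.prems subspace_hyperplane)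
    have vv: "v \<bullet> v = 1" using v by (simp add: norm_eq_1)
    have "v \<notin> S'" by (simp add: S'_def vv)
    then have "S' \<subset> S" using v(1) unfolding S'_def by blast
    then have "dim S' < dim S"
      using dim_psubset[of S' S] sub' less.prems(1) by (metis span_eq_iff)
    moreover have "T ` S' \<subseteq> S'"
      using less.prems v by (auto simp: S'_def sym[symmetric])
    ultimately obtain B where B: "B \<subseteq> S'" "finite B" "pairwise orthogonal B"
      "\<forall>v\<in>B. norm v = 1" "span B = S'" "\<forall>v\<in>B. \<exists>e. T v = e *\<^sub>R v"
      using less.hyps[of S'] sub' by blast
    have "span (insert v B) = S"
    proof
      show "span (insert v B) \<subseteq> S"
        using v B less.prems by (intro span_minimal) (auto simp: S'_def)
      show "S \<subseteq> span (insert v B)"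
      proof
        fix x assume "x \<in> S"
        then have "x - (v \<bullet> x) *\<^sub>R v \<in> S'"
          using v less.prems by (simp add: S'_def inner_diff_right vv subspace_diff subspace_scale)
        then show "x \<in> span (insert v B)"
          using B by (auto simp: span_breakdown_eq)
      qed
    qed
    moreover have "pairwise orthogonal (insert v B)"
      using B by (auto simp: pairwise_insert orthogonal_def S'_def inner_commute)
    ultimately show ?thesis
      using B v by (intro exI[of _ "insert v B"]) (auto simp: S'_def)
  qed
qed

section \<open>Eigenvalue multisets and singular value decomposition\<close>

text \<open>Each eigenspace is spanned by the basis vectors with that eigenvalue, so its dimension
  counts them. Hence the multiset can be read off any orthonormal eigenbasis.\<close>

lemma eigenvalues_eq_image_mset:
  fixes B :: "real^'n^'n"
  assumes sym: "\<And>x y. (B *v x) \<bullet> y = x \<bullet> (B *v y)"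
    and V: "finite V" "pairwise orthogonal V" "\<And>v. v \<in> V \<Longrightarrow> norm v = 1" "span V = UNIV"
    and ev: "\<And>v. v \<in> V \<Longrightarrow> B *v v = ev v *\<^sub>R v"
  shows "eigenvalues B = image_mset ev (mset_set V)"
proof -
  have eig: "eigenspace B e = span {v \<in> V. ev v = e}" for e
  proof
    show "span {v \<in> V. ev v = e} \<subseteq> eigenspace B e"
      by (rule span_minimal)
        (auto simp: eigenspace_def ev subspace_def matrix_vector_right_distrib
          matrix_vector_mult_scaleR scaleR_add_right)
    show "eigenspace B e \<subseteq> span {v \<in> V. ev v = e}"
    proof
      fix x assume "x \<in> eigenspace B e"
      then have x: "B *v x = e *\<^sub>R x" by (simp add: eigenspace_def)
      \<comment> \<open>By symmetry, eigenvectors for different eigenvalues are orthogonal; these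
        coefficients drop out of the expansion of \<open>x\<close>.\<close>
      have 0: "x \<bullet> v = 0" if "v \<in> V" "ev v \<noteq> e" for v
        using sym[of x v] x ev[OF that(1)] that by simp
      have "x = (\<Sum>v\<in>V. (x \<bullet> v) *\<^sub>R v)"
        using orthonormal_basis_expand[OF V(2,3) _ V(1), of x] V(4) by simp
      also have "\<dots> = (\<Sum>v\<in>{v \<in> V. ev v = e}. (x \<bullet> v) *\<^sub>R v)"
        using V(1) 0 by (intro sum.mono_neutral_right) auto
      finally show "x \<in> span {v \<in> V. ev v = e}"
        by (metis (no_types, lifting) span_base span_scale span_sum)
    qed
  qed
  have ind: "independent {v \<in> V. ev v = e}" for e
    using V(2) V(3)[of 0] by (intro pairwise_orthogonal_independent) (auto simp: pairwise_def)
  have dim: "dim (eigenspace B e) = card {v \<in> V. ev v = e}" for e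
    by (simp add: eig dim_eq_card_independent ind)
  have spec: "{e. \<exists>v. v \<noteq> 0 \<and> B *v v = e *\<^sub>R v} = ev ` V"
  proof (intro equalityI subsetI)
    fix e assume "e \<in> {e. \<exists>v. v \<noteq> 0 \<and> B *v v = e *\<^sub>R v}"
    then obtain v where v: "v \<noteq> 0" "v \<in> eigenspace B e" by (auto simp: eigenspace_def)
    then have "{v \<in> V. ev v = e} \<noteq> {}"
      unfolding eig by (metis span_empty singletonD)
    then show "e \<in> ev ` V" by auto
  next
    fix e assume "e \<in> ev ` V"
    then obtain v where "v \<in> V" "e = ev v" by blast
    then show "e \<in> {e. \<exists>v. v \<noteq> 0 \<and> B *v v = e *\<^sub>R v}"
      using V(3)[of v] ev[of v] by (auto intro!: exI[of _ v])
  qed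
  show ?thesis
  proof (rule multiset_eqI)
    fix e
    have "count (eigenvalues B) e
      = (\<Sum>x\<in>ev ` V. if e = x then card {v \<in> V. ev v = x} else 0)"
      by (simp add: eigenvalues_def spec dim count_sum)
    also have "\<dots> = card {v \<in> V. ev v = e}"
      using V(1) by (auto intro: arg_cong[of _ _ card])
    also have "\<dots> = count (image_mset ev (mset_set V)) e"
      using V(1) by (simp add: count_image_mset_eq_card_vimage)
    finally show "count (eigenvalues B) e = count (image_mset ev (mset_set V)) e" .
  qed
qed

text \<open>\<open>V\<close> is an orthonormal eigenbasis of the Gram matrix, that is, a set of
  right singular vectors. Since the Gram form of \<open>x\<close> and \<open>y\<close> is
  \<open>(A *v x) \<bullet> (A *v y)\<close>, the images of \<open>V\<close> are orthogonal and
  their lengths are the singular values. Normalising these images later yields the left singular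
  vectors.\<close>

lemma singular_values_orthonormal_basis:
  fixes A :: "real^'n^'m"
  obtains V where "finite V" "pairwise orthogonal V" "\<And>v. v \<in> V \<Longrightarrow> norm v = 1" "span V = UNIV"
    "\<And>v w. v \<in> V \<Longrightarrow> w \<in> V \<Longrightarrow> v \<noteq> w \<Longrightarrow> (A *v v) \<bullet> (A *v w) = 0"
    "singular_values A = image_mset (\<lambda>v. norm (A *v v)) (mset_set V)"
proof -
  let ?B = "transpose A ** A"
  have inner: "(?B *v x) \<bullet> y = (A *v x) \<bullet> (A *v y)" for x y
    by (metis dot_lmul_matrix matrix_vector_mul_assoc transpose_matrix_vector)
  have sym: "(?B *v x) \<bullet> y = x \<bullet> (?B *v y)" for x y
    using inner[of x y] inner[of y x] by (simp add: inner_commute)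
  obtain V where V: "finite V" "pairwise orthogonal V" "\<forall>v\<in>V. norm v = 1" "span V = UNIV"
    and "\<forall>v\<in>V. \<exists>e. ?B *v v = e *\<^sub>R v"
    using selfadjoint_orthonormal_eigenbasis_subspace[of "(*v) ?B" UNIV] sym by auto
  then obtain ev where ev: "\<And>v. v \<in> V \<Longrightarrow> ?B *v v = ev v *\<^sub>R v"
    by metis
  have nrm: "sqrt (ev v) = norm (A *v v)" if "v \<in> V" for v
    using inner[of v v] ev[OF that] V(3) that by (simp add: norm_eq_sqrt_inner)
  have "singular_values A = image_mset (\<lambda>v. sqrt (ev v)) (mset_set V)"
    using eigenvalues_eq_image_mset[OF sym V(1,2) _ V(4) ev] V(3)
    by (simp add: singular_values_def multiset.map_comp comp_def)
  also have "\<dots> = image_mset (\<lambda>v. norm (A *v v)) (mset_set V)"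
    using V(1) nrm by (intro image_mset_cong) auto
  finally show ?thesis
  proof (rule that[OF V(1,2) _ V(4), rotated 2])
    fix v w assume "v \<in> V" "w \<in> V" "v \<noteq> w"
    then show "(A *v v) \<bullet> (A *v w) = 0"
      using inner[of v w] ev[of v] V(2) by (simp add: pairwise_def orthogonal_def)
  qed (use V(3) in auto)
qed

section \<open>Bessel's inequality and a Hoelder inequality for substochastic matrices\<close>

text \<open>The vectors may be shorter than 1, so that left singular vectors belonging to the
  singular value 0 can be taken to be 0. With \<open>y\<close> as below,
  \<open>y \<bullet> y \<le> x \<bullet> y\<close>, and expanding
  \<open>(x - y) \<bullet> (x - y) \<ge> 0\<close> gives the claim.\<close>

lemma Bessel_inequality:
  fixes u :: "'i \<Rightarrow> 'a::real_inner"
  assumes "finite I" and norm: "\<And>i. i \<in> I \<Longrightarrow> norm (u i) \<le> 1"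
    and orth: "\<And>i j. i \<in> I \<Longrightarrow> j \<in> I \<Longrightarrow> i \<noteq> j \<Longrightarrow> u i \<bullet> u j = 0"
  shows "(\<Sum>i\<in>I. (u i \<bullet> x)\<^sup>2) \<le> (norm x)\<^sup>2"
proof -
  define y where "y = (\<Sum>i\<in>I. (u i \<bullet> x) *\<^sub>R u i)"
  have xy: "x \<bullet> y = (\<Sum>i\<in>I. (u i \<bullet> x)\<^sup>2)"
    by (simp add: y_def inner_sum_right power2_eq_square inner_commute)
  have "y \<bullet> y = (\<Sum>i\<in>I. (u i \<bullet> x) * (u i \<bullet> y))"
    by (subst (1) y_def) (simp add: inner_sum_left)
  also have "\<dots> = (\<Sum>i\<in>I. (u i \<bullet> x)\<^sup>2 * (u i \<bullet> u i))"
  proof (intro sum.cong refl)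
    fix i assume "i \<in> I"
    have "u i \<bullet> y = (\<Sum>j\<in>I. if j = i then (u i \<bullet> x) * (u i \<bullet> u i) else 0)"
      unfolding y_def inner_sum_right using orth[OF \<open>i \<in> I\<close>] by (intro sum.cong) auto
    then show "(u i \<bullet> x) * (u i \<bullet> y) = (u i \<bullet> x)\<^sup>2 * (u i \<bullet> u i)"
      using \<open>i \<in> I\<close> assms(1) by (simp add: power2_eq_square)
  qed
  also have "\<dots> \<le> (\<Sum>i\<in>I. (u i \<bullet> x)\<^sup>2)"
    using norm by (intro sum_mono mult_left_le) (auto simp: norm_le_square power2_eq_square)
  finally have "y \<bullet> y \<le> x \<bullet> y" using xy by simp
  moreover have "0 \<le> (x - y) \<bullet> (x - y)" by simp
  ultimately show ?thesis
    using xy by (simp add: inner_diff_left inner_diff_right inner_commute[of y x] power2_norm_eq_inner)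
qed

text \<open>Young's inequality is applied entrywise, to the normalised vectors.\<close>

lemma substochastic_Hoelder:
  fixes D :: "'i \<Rightarrow> 'j \<Rightarrow> real" and q :: real
  assumes q: "1 \<le> q" and fin: "finite I" "finite J"
    and x: "\<And>i. i \<in> I \<Longrightarrow> 0 \<le> x i" and s: "\<And>j. j \<in> J \<Longrightarrow> 0 \<le> s j"
    and D: "\<And>i j. i \<in> I \<Longrightarrow> j \<in> J \<Longrightarrow> 0 \<le> D i j"
    and row: "\<And>i. i \<in> I \<Longrightarrow> (\<Sum>j\<in>J. D i j) \<le> 1"
    and col: "\<And>j. j \<in> J \<Longrightarrow> (\<Sum>i\<in>I. D i j) \<le> 1"
  shows "(\<Sum>i\<in>I. \<Sum>j\<in>J. x i powr (q - 1) * s j * D i j)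
    \<le> (\<Sum>i\<in>I. x i powr q) powr ((q - 1) / q) * (\<Sum>j\<in>J. s j powr q) powr (1 / q)"
    (is "?L \<le> ?a powr _ * ?b powr _")
proof (cases "?a = 0 \<or> ?b = 0")
  case True
  then have "(\<forall>i\<in>I. x i = 0) \<or> (\<forall>j\<in>J. s j = 0)"
    using fin by (simp add: sum_nonneg_eq_0_iff)
  \<comment> \<open>For \<open>q = 1\<close> this relies on the convention
    \<open>0 powr 0 = 0\<close>.\<close>
  then have "?L = 0" by (auto intro!: sum.neutral)
  then show ?thesis by simp
next
  case False
  then have a: "?a > 0" and b: "?b > 0"
    by (simp_all add: less_le sum_nonneg)
  let ?\<alpha> = "(q - 1) / q" and ?\<beta> = "1 / q"
  have entry: "x i powr (q - 1) * s j * D i j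
      \<le> (?a powr ?\<alpha> * ?b powr ?\<beta>) * ((?\<alpha> * (x i powr q / ?a) + ?\<beta> * (s j powr q / ?b)) * D i j)"
    if "i \<in> I" "j \<in> J" for i j
  proof (cases "x i = 0 \<or> s j = 0")
    case True
    then show ?thesis
      using a b q x s D that by (auto intro!: mult_nonneg_nonneg add_nonneg_nonneg)
  next
    case False
    then have pos: "x i > 0" "s j > 0"
      using x[OF that(1)] s[OF that(2)] by auto
    have "(x i powr q / ?a) powr ?\<alpha> * (s j powr q / ?b) powr ?\<beta>
        \<le> ?\<alpha> * (x i powr q / ?a) + ?\<beta> * (s j powr q / ?b)"
      using q a b pos by (intro Youngs_inequality_0) (auto simp: field_simps)
    moreover have "(x i powr q / ?a) powr ?\<alpha> = x i powr (q - 1) / ?a powr ?\<alpha>"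
      using q a pos by (simp add: powr_divide powr_powr)
    moreover have "(s j powr q / ?b) powr ?\<beta> = s j / ?b powr ?\<beta>"
      using q b pos by (simp add: powr_divide powr_powr)
    ultimately have "x i powr (q - 1) * s j
        \<le> (?a powr ?\<alpha> * ?b powr ?\<beta>) * (?\<alpha> * (x i powr q / ?a) + ?\<beta> * (s j powr q / ?b))"
      using a b by (simp add: divide_le_eq mult_ac)
    from mult_right_mono[OF this D[OF that]] show ?thesis by (simp only: mult.assoc)
  qed
  \<comment> \<open>The Young bound separates into a term in \<open>i\<close> and a term in
    \<open>j\<close>. Row sums absorb \<open>D\<close> in the first, column sums in the second; the
    normalised powers sum to 1, which leaves the two weights.\<close>
  have "(\<Sum>i\<in>I. \<Sum>j\<in>J. (?\<alpha> * (x i powr q / ?a) + ?\<beta> * (s j powr q / ?b)) * D i j)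
      = (\<Sum>i\<in>I. ?\<alpha> * (x i powr q / ?a) * (\<Sum>j\<in>J. D i j))
        + (\<Sum>i\<in>I. \<Sum>j\<in>J. ?\<beta> * (s j powr q / ?b) * D i j)"
    by (simp add: distrib_right sum.distrib sum_distrib_left)
  also have "(\<Sum>i\<in>I. \<Sum>j\<in>J. ?\<beta> * (s j powr q / ?b) * D i j)
      = (\<Sum>j\<in>J. ?\<beta> * (s j powr q / ?b) * (\<Sum>i\<in>I. D i j))"
    by (subst sum.swap) (simp add: sum_distrib_left)
  also have "(\<Sum>i\<in>I. ?\<alpha> * (x i powr q / ?a) * (\<Sum>j\<in>J. D i j)) \<le> (\<Sum>i\<in>I. ?\<alpha> * (x i powr q / ?a))"
    using q a row by (intro sum_mono mult_left_le) auto
  also have "\<dots> = ?\<alpha>"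
    using a by (simp add: sum_distrib_left[symmetric] sum_divide_distrib[symmetric])
  also have "(\<Sum>j\<in>J. ?\<beta> * (s j powr q / ?b) * (\<Sum>i\<in>I. D i j)) \<le> (\<Sum>j\<in>J. ?\<beta> * (s j powr q / ?b))"
    using q b col by (intro sum_mono mult_left_le) auto
  also have "\<dots> = ?\<beta>"
    using b by (simp add: sum_distrib_left[symmetric] sum_divide_distrib[symmetric])
  also have "?\<alpha> + ?\<beta> = 1"
    using q by (simp add: field_simps)
  finally have 1: "(\<Sum>i\<in>I. \<Sum>j\<in>J. (?\<alpha> * (x i powr q / ?a) + ?\<beta> * (s j powr q / ?b)) * D i j) \<le> 1"
    by simp
  have "?L \<le> (\<Sum>i\<in>I. \<Sum>j\<in>J. (?a powr ?\<alpha> * ?b powr ?\<beta>)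
      * ((?\<alpha> * (x i powr q / ?a) + ?\<beta> * (s j powr q / ?b)) * D i j))"
    by (intro sum_mono entry)
  also have "\<dots> = (?a powr ?\<alpha> * ?b powr ?\<beta>)
      * (\<Sum>i\<in>I. \<Sum>j\<in>J. (?\<alpha> * (x i powr q / ?a) + ?\<beta> * (s j powr q / ?b)) * D i j)"
    by (simp only: sum_distrib_left)
  also have "\<dots> \<le> ?a powr ?\<alpha> * ?b powr ?\<beta>"
    using 1 by (intro mult_left_le) auto
  finally show ?thesis .
qed

section \<open>Schatten norms and their supporting functionals\<close>

lemma lp_norm_image_mset:
  assumes "finite V"
  shows "lp_norm (ereal q) (image_mset f (mset_set V)) = (\<Sum>v\<in>V. \<bar>f v\<bar> powr q) powr (1 / q)"
  by (simp add: lp_norm_def multiset.map_comp comp_def sum_unfold_sum_mset)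

text \<open>Expanding \<open>x\<close> in right singular vectors and applying Pythagoras to the
  orthogonal images bounds \<open>norm (A *v x)\<close> by the largest singular value; a singular
  vector for that value attains it. This vector is kept because the supporting functional for
  \<open>p = \<infinity>\<close> is built from it.\<close>

lemma schatten_norm_infinity_attained:
  fixes A :: "real^'n^'m"
  obtains v where "norm v = 1" "norm (A *v v) = schatten_norm \<infinity> A"
    "schatten_norm \<infinity> A = onorm ((*v) A)"
proof -
  obtain V where V: "finite V" "pairwise orthogonal V" "\<And>v. v \<in> V \<Longrightarrow> norm v = 1" "span V = UNIV"
    and orth: "\<And>v w. v \<in> V \<Longrightarrow> w \<in> V \<Longrightarrow> v \<noteq> w \<Longrightarrow> (A *v v) \<bullet> (A *v w) = 0"
    and sv: "singular_values A = image_mset (\<lambda>v. norm (A *v v)) (mset_set V)"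
    using singular_values_orthonormal_basis[of A] by blast
  define M where "M = schatten_norm \<infinity> A"
  have M: "M = Max ((\<lambda>v. norm (A *v v)) ` V)"
    using V(1) by (simp add: M_def schatten_norm_def lp_norm_def sv image_image)
  \<comment> \<open>\<open>Max\<close> is only meaningful on a nonempty set; index types are
    nonempty, so the space is not zero.\<close>
  have "V \<noteq> {}"
  proof
    assume "V = {}"
    then have "axis undefined 1 \<in> {0 :: real^'n}" using V(4) by (metis UNIV_I span_empty)
    then show False by simp
  qed
  then have "M \<in> (\<lambda>v. norm (A *v v)) ` V"
    unfolding M using V(1) by (intro Max_in) auto
  then obtain v where v: "v \<in> V" "norm (A *v v) = M" by auto
  have "onorm ((*v) A) \<le> M"
  proof (rule onorm_le)
    fix x
    have x: "x = (\<Sum>v\<in>V. (x \<bullet> v) *\<^sub>R v)"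
      using orthonormal_basis_expand[OF V(2,3) _ V(1), of x] V(4) by simp
    have "A *v x = (\<Sum>v\<in>V. (x \<bullet> v) *\<^sub>R (A *v v))"
      by (subst x) (simp add: linear_sum[OF matrix_vector_mul_linear] linear_scale[OF matrix_vector_mul_linear])
    then have "(norm (A *v x))\<^sup>2 = (\<Sum>v\<in>V. (norm ((x \<bullet> v) *\<^sub>R (A *v v)))\<^sup>2)"
      using V(1) orth by (simp add: norm_sum_Pythagorean pairwise_def orthogonal_def)
    also have "\<dots> \<le> (\<Sum>v\<in>V. M\<^sup>2 * (x \<bullet> v)\<^sup>2)"
    proof (intro sum_mono)
      fix w assume "w \<in> V"
      then have "norm (A *v w) \<le> M" unfolding M using V(1) by auto
      then have "(norm (A *v w))\<^sup>2 \<le> M\<^sup>2" by (intro power_mono) auto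
      then show "(norm ((x \<bullet> w) *\<^sub>R (A *v w)))\<^sup>2 \<le> M\<^sup>2 * (x \<bullet> w)\<^sup>2"
        by (simp add: power_mult_distrib mult.commute[of "M\<^sup>2"] mult_left_mono)
    qed
    also have "\<dots> = M\<^sup>2 * (\<Sum>v\<in>V. (v \<bullet> x)\<^sup>2)"
      by (simp add: sum_distrib_left inner_commute)
    also have "\<dots> \<le> M\<^sup>2 * (norm x)\<^sup>2"
      using V by (intro mult_left_mono Bessel_inequality) (auto simp: pairwise_def orthogonal_def)
    also have "\<dots> = (M * norm x)\<^sup>2" by (simp add: power_mult_distrib)
    finally show "norm (A *v x) \<le> M * norm x"
      using v by (auto intro: power2_le_imp_le)
  qed
  moreover have "M \<le> onorm ((*v) A)"
    using onorm[OF matrix_vector_mul_bounded_linear, of A v] v V(3) by simp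
  ultimately show ?thesis
    using that[of v] v V(3) M_def by auto
qed

lemma schatten_norm_infinity_eq_onorm: "schatten_norm \<infinity> A = onorm ((*v) A)"
  by (rule schatten_norm_infinity_attained[of A])

text \<open>Expanding each \<open>v i\<close> in the right singular vectors of \<open>B\<close>
  turns the left side into a double sum over singular vectors, to which
  \<open>substochastic_Hoelder\<close> applies.\<close>

lemma sum_inner_orthonormal_le_schatten_norm:
  fixes B :: "real^'n^'m" and q :: real
  assumes q: "1 \<le> q" and "finite I" and x: "\<And>i. i \<in> I \<Longrightarrow> 0 \<le> x i"
    and u: "\<And>i. i \<in> I \<Longrightarrow> norm (u i) \<le> 1"
      "\<And>i j. i \<in> I \<Longrightarrow> j \<in> I \<Longrightarrow> i \<noteq> j \<Longrightarrow> u i \<bullet> u j = 0"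
    and v: "\<And>i. i \<in> I \<Longrightarrow> norm (v i) \<le> 1"
      "\<And>i j. i \<in> I \<Longrightarrow> j \<in> I \<Longrightarrow> i \<noteq> j \<Longrightarrow> v i \<bullet> v j = 0"
  shows "(\<Sum>i\<in>I. x i powr (q - 1) * (u i \<bullet> (B *v v i)))
    \<le> (\<Sum>i\<in>I. x i powr q) powr ((q - 1) / q) * schatten_norm (ereal q) B"
proof -
  obtain Z where Z: "finite Z" "pairwise orthogonal Z" "\<And>z. z \<in> Z \<Longrightarrow> norm z = 1" "span Z = UNIV"
    and orth: "\<And>z w. z \<in> Z \<Longrightarrow> w \<in> Z \<Longrightarrow> z \<noteq> w \<Longrightarrow> (B *v z) \<bullet> (B *v w) = 0"
    and sv: "singular_values B = image_mset (\<lambda>z. norm (B *v z)) (mset_set Z)"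
    using singular_values_orthonormal_basis[of B] by blast
  \<comment> \<open>If \<open>B *v z = 0\<close>, then \<open>w z = 0\<close> by
    \<open>inverse 0 = 0\<close>, hence only \<open>norm (w z) \<le> 1\<close>.\<close>
  define w where "w z = B *v z /\<^sub>R norm (B *v z)" for z
  have w: "norm (w z) \<le> 1" "B *v z = norm (B *v z) *\<^sub>R w z" for z
    by (cases "B *v z = 0"; simp add: w_def)+
  have worth: "w z \<bullet> w z' = 0" if "z \<in> Z" "z' \<in> Z" "z \<noteq> z'" for z z'
    using orth[OF that] by (simp add: w_def)
  have Zorth: "z \<bullet> z' = 0" if "z \<in> Z" "z' \<in> Z" "z \<noteq> z'" for z z'
    using Z(2) that by (simp add: pairwise_def orthogonal_def)
  \<comment> \<open>The arithmetic mean of the squares dominates the product of the two inner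
    products, and Bessel's inequality bounds its row and column sums directly.\<close>
  define D where "D i z = ((u i \<bullet> w z)\<^sup>2 + (v i \<bullet> z)\<^sup>2) / 2" for i z
  have expand: "u i \<bullet> (B *v v i) = (\<Sum>z\<in>Z. norm (B *v z) * ((u i \<bullet> w z) * (v i \<bullet> z)))" for i
  proof -
    have y: "v i = (\<Sum>z\<in>Z. (v i \<bullet> z) *\<^sub>R z)"
      using orthonormal_basis_expand[OF Z(2,3) _ Z(1), of "v i"] Z(4) by simp
    have "B *v v i = (\<Sum>z\<in>Z. (v i \<bullet> z) *\<^sub>R (B *v z))"
      by (subst y) (simp add: linear_sum[OF matrix_vector_mul_linear] linear_scale[OF matrix_vector_mul_linear])
    also have "\<dots> = (\<Sum>z\<in>Z. (v i \<bullet> z) *\<^sub>R (norm (B *v z) *\<^sub>R w z))"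
      using w(2) by metis
    finally show ?thesis
      by (simp add: inner_sum_right mult_ac)
  qed
  have "(\<Sum>i\<in>I. x i powr (q - 1) * (u i \<bullet> (B *v v i)))
      \<le> (\<Sum>i\<in>I. \<Sum>z\<in>Z. x i powr (q - 1) * norm (B *v z) * D i z)"
  proof (intro sum_mono)
    fix i assume "i \<in> I"
    have "(u i \<bullet> w z) * (v i \<bullet> z) \<le> D i z" for z
      using sum_squares_bound[of "u i \<bullet> w z" "v i \<bullet> z"] by (simp add: D_def)
    then show "x i powr (q - 1) * (u i \<bullet> (B *v v i))
        \<le> (\<Sum>z\<in>Z. x i powr (q - 1) * norm (B *v z) * D i z)"
      unfolding expand sum_distrib_left mult.assoc by (intro sum_mono mult_left_mono) auto
  qed
  also have "\<dots> \<le> (\<Sum>i\<in>I. x i powr q) powr ((q - 1) / q)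
      * (\<Sum>z\<in>Z. norm (B *v z) powr q) powr (1 / q)"
  proof (rule substochastic_Hoelder[OF q assms(2) Z(1)])
    fix i assume i: "i \<in> I"
    have "(\<Sum>z\<in>Z. (u i \<bullet> w z)\<^sup>2) \<le> (norm (u i))\<^sup>2"
      using Bessel_inequality[of Z w "u i"] Z(1) w(1) worth by (simp add: inner_commute)
    also have "\<dots> \<le> 1" using u(1)[OF i] by (simp add: power_le_one)
    moreover have "(\<Sum>z\<in>Z. (v i \<bullet> z)\<^sup>2) \<le> (norm (v i))\<^sup>2"
      using Bessel_inequality[of Z "\<lambda>z. z" "v i"] Z Zorth by (simp add: inner_commute)
    then have "(\<Sum>z\<in>Z. (v i \<bullet> z)\<^sup>2) \<le> 1"
      using power_le_one[OF norm_ge_zero v(1)[OF i], of 2] by linarith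
    ultimately show "(\<Sum>z\<in>Z. D i z) \<le> 1"
      by (simp add: D_def sum_divide_distrib[symmetric] sum.distrib)
  next
    fix z assume z: "z \<in> Z"
    have "(\<Sum>i\<in>I. (u i \<bullet> w z)\<^sup>2) \<le> (norm (w z))\<^sup>2"
      by (rule Bessel_inequality[OF assms(2) u])
    also have "\<dots> \<le> 1" using w(1) by (simp add: power_le_one)
    moreover have "(\<Sum>i\<in>I. (v i \<bullet> z)\<^sup>2) \<le> (norm z)\<^sup>2"
      by (rule Bessel_inequality[OF assms(2) v])
    ultimately show "(\<Sum>i\<in>I. D i z) \<le> 1"
      using Z(3)[OF z] by (simp add: D_def sum_divide_distrib[symmetric] sum.distrib)
  qed (use x in \<open>auto simp: D_def\<close>)
  also have "(\<Sum>z\<in>Z. norm (B *v z) powr q) powr (1 / q) = schatten_norm (ereal q) B"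
    by (simp add: schatten_norm_def sv lp_norm_image_mset[OF Z(1)])
  finally show ?thesis .
qed

text \<open>The functional realises the equality case of Hoelder's inequality: it pairs
  \<open>B\<close> with the matrix that has the singular vectors of \<open>A\<close> and suitably
  weighted singular values.\<close>

lemma schatten_norm_supporting_functional:
  fixes A :: "real^'n^'m"
  assumes "1 \<le> p"
  shows "\<exists>\<phi>. linear \<phi> \<and> \<phi> A = schatten_norm p A \<and> (\<forall>B. \<phi> B \<le> schatten_norm p B)"
proof (cases p)
  case PInf
  obtain v where v: "norm v = 1" "norm (A *v v) = schatten_norm \<infinity> A"
    by (rule schatten_norm_infinity_attained[of A])
  define u where "u = A *v v /\<^sub>R norm (A *v v)"
  have u: "norm u \<le> 1" by (cases "A *v v = 0") (auto simp: u_def)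
  let ?\<phi> = "\<lambda>B :: real^'n^'m. u \<bullet> (B *v v)"
  have "linear ?\<phi>"
    by (rule linearI)
      (simp_all add: matrix_vector_mult_add_rdistrib inner_add_right scaleR_matrix_vector_assoc[symmetric])
  moreover have "?\<phi> A = schatten_norm \<infinity> A"
    unfolding v(2)[symmetric]
    by (cases "A *v v = 0") (simp_all add: u_def dot_square_norm power2_eq_square)
  moreover have "?\<phi> B \<le> schatten_norm \<infinity> B" for B
  proof -
    have "?\<phi> B \<le> norm u * norm (B *v v)" by (rule norm_cauchy_schwarz)
    also have "\<dots> \<le> norm (B *v v)" using u by (simp add: mult_left_le_one_le)
    also have "\<dots> \<le> schatten_norm \<infinity> B"
      using onorm[OF matrix_vector_mul_bounded_linear, of B v] v(1)
      by (simp add: schatten_norm_infinity_eq_onorm)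
    finally show ?thesis .
  qed
  ultimately show ?thesis using PInf by blast
next
  case (real q)
  then have q: "1 \<le> q" using assms by simp
  obtain V where V: "finite V" "pairwise orthogonal V" "\<And>v. v \<in> V \<Longrightarrow> norm v = 1" "span V = UNIV"
    and orth: "\<And>v w. v \<in> V \<Longrightarrow> w \<in> V \<Longrightarrow> v \<noteq> w \<Longrightarrow> (A *v v) \<bullet> (A *v w) = 0"
    and sv: "singular_values A = image_mset (\<lambda>v. norm (A *v v)) (mset_set V)"
    using singular_values_orthonormal_basis[of A] by blast
  define u where "u v = A *v v /\<^sub>R norm (A *v v)" for v
  have u: "norm (u v) \<le> 1" for v
    by (cases "A *v v = 0") (auto simp: u_def)
  define a where "a = (\<Sum>v\<in>V. norm (A *v v) powr q)"
  have hA: "schatten_norm p A = a powr (1 / q)"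
    by (simp add: schatten_norm_def sv lp_norm_image_mset[OF V(1)] real a_def)
  \<comment> \<open>The weights are \<open>\<sigma> powr (q - 1)\<close>, as in the gradient of the
    norm, and the denominator is the \<open>(q - 1)\<close>-th power of the norm of
    \<open>A\<close>. If \<open>a = 0\<close>, division by zero makes the functional 0, which is
    right since the norm of \<open>A\<close> is then 0.\<close>
  let ?\<phi> = "\<lambda>B :: real^'n^'m. (\<Sum>v\<in>V. norm (A *v v) powr (q - 1) * (u v \<bullet> (B *v v))) / a powr ((q - 1) / q)"
  have "linear ?\<phi>"
    by (rule linearI)
      (simp_all add: matrix_vector_mult_add_rdistrib inner_add_right scaleR_matrix_vector_assoc[symmetric]
        distrib_left sum.distrib add_divide_distrib sum_distrib_left mult.left_commute)
  moreover have "?\<phi> A = schatten_norm p A"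
  proof -
    have "norm (A *v v) powr (q - 1) * (u v \<bullet> (A *v v)) = norm (A *v v) powr q" for v
    proof (cases "A *v v = 0")
      case False
      then have "u v \<bullet> (A *v v) = norm (A *v v)"
        by (simp add: u_def dot_square_norm power2_eq_square)
      moreover have "norm (A *v v) powr (q - 1) * norm (A *v v) = norm (A *v v) powr q"
        using False by (simp add: powr_diff)
      ultimately show ?thesis by simp
    qed simp
    then have "?\<phi> A = a / a powr ((q - 1) / q)" by (simp add: a_def)
    also have "\<dots> = a powr (1 / q)"
    proof (cases "a = 0")
      case False
      then have "a > 0" by (simp add: a_def less_le sum_nonneg)
      then have "a / a powr ((q - 1) / q) = a powr (1 - (q - 1) / q)" by (simp add: powr_diff)
      also have "1 - (q - 1) / q = 1 / q" using q by (simp add: field_simps)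
      finally show ?thesis .
    qed simp
    finally show ?thesis using hA by simp
  qed
  moreover have "?\<phi> B \<le> schatten_norm p B" for B
  proof -
    have "(\<Sum>v\<in>V. norm (A *v v) powr (q - 1) * (u v \<bullet> (B *v v)))
        \<le> a powr ((q - 1) / q) * schatten_norm (ereal q) B"
      unfolding a_def using V orth
      by (intro sum_inner_orthonormal_le_schatten_norm q V(1) u)
        (auto simp: u_def pairwise_def orthogonal_def)
    moreover have "0 \<le> schatten_norm (ereal q) B"
      by (simp add: schatten_norm_def lp_norm_def)
    ultimately show ?thesis
      unfolding real by (cases "a = 0") (auto simp: divide_le_eq mult.commute)
  qed
  ultimately show ?thesis by blast
qed (use assms in auto)

section \<open>Sign invariance and comparison of matrix norms\<close>

lemma schatten_norm_minus: "schatten_norm p (- A) = schatten_norm p A"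
proof -
  have "transpose (- A) ** (- A) = transpose A ** A"
    by (simp add: matrix_matrix_mult_def transpose_def vec_eq_iff)
  then show ?thesis by (simp add: schatten_norm_def singular_values_def)
qed

lemma frobenius_norm_eq_norm: "frobenius_norm A = norm A"
  by (simp add: frobenius_norm_def norm_vec_def L2_set_def sum_nonneg)

text \<open>Every entry is at most the operator norm. The crude constant is enough to make the
  operator norm definite and the objective coercive.\<close>

lemma norm_le_onorm_matrix:
  fixes A :: "real^'n^'m"
  shows "norm A \<le> (real CARD('m) * real CARD('n)) * onorm ((*v) A)"
proof -
  have "norm A \<le> (\<Sum>i\<in>UNIV. norm (A $ i))"
    by (simp add: norm_vec_def L2_set_le_sum)
  also have "\<dots> \<le> (\<Sum>i\<in>(UNIV::'m set). \<Sum>j\<in>(UNIV::'n set). \<bar>A $ i $ j\<bar>)"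
    by (intro sum_mono norm_le_l1_cart)
  also have "\<dots> \<le> (\<Sum>i\<in>(UNIV::'m set). \<Sum>j\<in>(UNIV::'n set). onorm ((*v) A))"
    by (intro sum_mono matrix_component_le_onorm)
  finally show ?thesis by simp
qed

section \<open>Robust and regularised minimisation for general norms\<close>

text \<open>Stated for abstract \<open>g\<close> and \<open>h\<close> to cover both choices of loss.
  \<open>h\<close> enters through supporting functionals, which yield its nonnegativity and
  convexity; the comparison of \<open>g\<close> with \<open>norm\<close> yields definiteness and
  coercivity.\<close>

lemma robust_min_max:
  fixes g h :: "real^'n^'m \<Rightarrow> real" and Y :: "real^'n^'m"
  assumes lam: "lam > 0"
    and g_scale: "\<And>c X. g (c *\<^sub>R X) = \<bar>c\<bar> * g X"
    and g_add: "\<And>X X'. g (X + X') \<le> g X + g X'"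
    and c: "\<And>X. norm X \<le> c * g X" "c > 0"
    and h_minus: "\<And>X. h (- X) = h X"
    and h_supp: "\<And>X. \<exists>\<phi>. linear \<phi> \<and> \<phi> X = h X \<and> (\<forall>X'. \<phi> X' \<le> h X')"
  shows "\<exists>M v. (\<forall>X. is_max_on (\<lambda>\<Delta>. g (Y - X - \<Delta> X)) (uncertainty_set lam h g) (M X)) \<and>
    is_min_on M UNIV v \<and> is_min_on (\<lambda>X. g (Y - X) + lam * h X) UNIV v"
proof -
  define f where "f X = g (Y - X) + lam * h X" for X
  have g0: "0 \<le> g X" for X
    using c(1)[of X] c(2) by (smt (verit) norm_ge_zero zero_le_mult_iff)
  have g_minus: "g (- X) = g X" for X
    using g_scale[of "-1" X] by simp
  \<comment> \<open>Membership in the uncertainty set involves \<open>\<bar>\<phi> W\<bar>\<close>,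
    so the one-sided bound is applied at both \<open>W\<close> and \<open>- W\<close>.\<close>
  have supp: "\<exists>\<phi>. linear \<phi> \<and> \<phi> X = h X \<and> (\<forall>W. \<bar>\<phi> W\<bar> \<le> h W)" for X
  proof -
    obtain \<phi> where \<phi>: "linear \<phi>" "\<phi> X = h X" "\<And>W. \<phi> W \<le> h W"
      using h_supp by blast
    have "\<bar>\<phi> W\<bar> \<le> h W" for W
      using \<phi>(3)[of W] \<phi>(3)[of "- W"] by (simp add: h_minus linear_neg[OF \<phi>(1)])
    with \<phi> show ?thesis by blast
  qed
  then have h0: "0 \<le> h X" for X by (metis abs_ge_zero order_trans)
  have max: "is_max_on (\<lambda>\<Delta>. g (Y - X - \<Delta> X)) (uncertainty_set lam h g) (f X)" for X
    unfolding is_max_on_def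
  proof
    show "\<forall>\<Delta>\<in>uncertainty_set lam h g. g (Y - X - \<Delta> X) \<le> f X"
    proof
      fix \<Delta> assume "\<Delta> \<in> uncertainty_set lam h g"
      then have "g (\<Delta> X) \<le> lam * h X" by (simp add: uncertainty_set_def)
      then show "g (Y - X - \<Delta> X) \<le> f X"
        using g_add[of "Y - X" "- \<Delta> X"] by (simp add: f_def g_minus)
    qed
    obtain Z where Z: "g Z = 1" "Y - X = g (Y - X) *\<^sub>R Z"
    proof -
      \<comment> \<open>If \<open>Y = X\<close>, there is no direction to normalise; any nonzero
        matrix serves, since \<open>g (Y - X) = 0\<close>.\<close>
      define R where "R = (if Y = X then axis undefined (axis undefined 1) else Y - X)"
      have "R \<noteq> 0" by (auto simp: R_def axis_eq_0_iff)
      then have "g R > 0" using c(1)[of R] g0[of R] c(2) by (smt (verit) zero_less_norm_iff mult_eq_0_iff)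
      moreover have "g (Y - X) = 0" if "Y = X" using g_scale[of 0 0] that by simp
      ultimately show ?thesis
        using that[of "R /\<^sub>R g R"] g_scale[of "inverse (g R)" R]
        by (cases "Y = X") (auto simp: R_def)
    qed
    obtain \<phi> where \<phi>: "linear \<phi>" "\<phi> X = h X" "\<And>W. \<bar>\<phi> W\<bar> \<le> h W"
      using supp by blast
    define \<Delta> where "\<Delta> W = - (lam * \<phi> W) *\<^sub>R Z" for W
    have "linear \<Delta>"
      unfolding \<Delta>_def
      by (rule linearI) (simp_all add: linear_add[OF \<phi>(1)] linear_scale[OF \<phi>(1)] algebra_simps)
    moreover have "g (\<Delta> W) \<le> lam * h W" for W
      using lam \<phi>(3)[of W] g_scale[of "- (lam * \<phi> W)" Z] Z(1)
      by (simp add: \<Delta>_def abs_mult)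
    moreover have "g (Y - X - \<Delta> X) = f X"
    proof -
      have "Y - X - \<Delta> X = (g (Y - X) + lam * h X) *\<^sub>R Z"
        by (subst Z(2)) (simp add: \<Delta>_def \<phi>(2) scaleR_add_left)
      then show ?thesis
        using g_scale[of "g (Y - X) + lam * h X" Z] Z(1) g0[of "Y - X"] h0[of X] lam
        by (simp add: f_def)
    qed
    ultimately show "\<exists>\<Delta>\<in>uncertainty_set lam h g. g (Y - X - \<Delta> X) = f X"
      by (intro bexI[of _ \<Delta>]) (auto simp: uncertainty_set_def)
  qed
  have "convex_on UNIV g"
  proof (rule convex_onI)
    fix t :: real and x y :: "real^'n^'m"
    assume "0 < t" "t < 1"
    then show "g ((1 - t) *\<^sub>R x + t *\<^sub>R y) \<le> (1 - t) * g x + t * g y"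
      using g_add[of "(1 - t) *\<^sub>R x" "t *\<^sub>R y"] by (simp add: g_scale)
  qed simp
  then have g_cont: "continuous_on UNIV g" by (intro convex_on_continuous) auto
  have "convex_on UNIV h"
  proof (rule convex_onI)
    fix t :: real and x y :: "real^'n^'m"
    assume t: "0 < t" "t < 1"
    \<comment> \<open>The functional is taken at the intermediate point: there it equals
      \<open>h\<close>, while at \<open>x\<close> and \<open>y\<close> it stays below.\<close>
    obtain \<phi> where \<phi>: "linear \<phi>" "\<phi> ((1 - t) *\<^sub>R x + t *\<^sub>R y) = h ((1 - t) *\<^sub>R x + t *\<^sub>R y)"
      "\<And>W. \<phi> W \<le> h W"
      using h_supp by blast
    have "h ((1 - t) *\<^sub>R x + t *\<^sub>R y) = (1 - t) * \<phi> x + t * \<phi> y"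
      using \<phi>(2) by (simp add: linear_add[OF \<phi>(1)] linear_scale[OF \<phi>(1)])
    also have "\<dots> \<le> (1 - t) * h x + t * h y"
      using t \<phi>(3) by (intro add_mono mult_left_mono) auto
    finally show "h ((1 - t) *\<^sub>R x + t *\<^sub>R y) \<le> (1 - t) * h x + t * h y" .
  qed simp
  then have h_cont: "continuous_on UNIV h" by (intro convex_on_continuous) auto
  have f_cont: "continuous_on UNIV f"
    unfolding f_def
    by (intro continuous_intros h_cont continuous_on_compose2[OF g_cont]) auto
  \<comment> \<open>A sublevel set that contains 0. On it \<open>g (Y - X) \<le> f 0\<close>, which
    bounds \<open>X\<close>, so \<open>f\<close> has a minimiser there; outside it \<open>f\<close>
    exceeds \<open>f 0\<close>.\<close>
  define K where "K = {X. f X \<le> f 0}"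
  have "norm X \<le> norm Y + c * f 0" if "X \<in> K" for X
  proof -
    have "norm X \<le> norm Y + norm (Y - X)" using norm_triangle_sub[of X Y] by (simp add: norm_minus_commute)
    also have "norm (Y - X) \<le> c * g (Y - X)" by (rule c(1))
    also have "\<dots> \<le> c * f 0"
    proof (rule mult_left_mono)
      have "0 \<le> lam * h X" using h0[of X] lam by simp
      then show "g (Y - X) \<le> f 0" using that by (simp add: K_def f_def)
    qed (use c(2) in simp)
    finally show ?thesis by simp
  qed
  then have "bounded K" by (auto simp: bounded_iff)
  moreover have "closed K"
    unfolding K_def by (intro closed_Collect_le f_cont continuous_on_const)
  ultimately have "compact K" by (simp add: compact_eq_bounded_closed)
  moreover have "0 \<in> K" by (simp add: K_def)
  ultimately obtain X0 where X0: "X0 \<in> K" "\<And>X. X \<in> K \<Longrightarrow> f X0 \<le> f X"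
    using continuous_attains_inf[of K f] continuous_on_subset[OF f_cont] by blast
  have "f X0 \<le> f X" for X
    using X0(2)[of X] X0(1) by (cases "X \<in> K") (auto simp: K_def)
  then have "is_min_on f UNIV (f X0)" by (auto simp: is_min_on_def)
  moreover have "f = (\<lambda>X. g (Y - X) + lam * h X)"
    by (simp add: f_def fun_eq_iff)
  ultimately show ?thesis
    using max by metis
qed

theorem corollary4:
  fixes lam :: real and Y :: "real^'n^'m" and p :: ereal
  assumes "lam > 0" and "1 \<le> p"
  shows "(\<exists>(M :: real^'n^'m \<Rightarrow> real) v.
            (\<forall>X. is_max_on (\<lambda>\<Delta>. frobenius_norm (Y - X - \<Delta> X))
                   (uncertainty_set lam (schatten_norm p) frobenius_norm) (M X)) \<and>
            is_min_on M UNIV v \<and>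
            is_min_on (\<lambda>X. frobenius_norm (Y - X) + lam * schatten_norm p X) UNIV v) \<and>
         (\<exists>(M :: real^'n^'m \<Rightarrow> real) v.
            (\<forall>X. is_max_on (\<lambda>\<Delta>. schatten_norm \<infinity> (Y - X - \<Delta> X))
                   (uncertainty_set lam (schatten_norm p) (schatten_norm \<infinity>)) (M X)) \<and>
            is_min_on M UNIV v \<and>
            is_min_on (\<lambda>X. schatten_norm \<infinity> (Y - X) + lam * schatten_norm p X) UNIV v)"
proof
  note h = schatten_norm_minus schatten_norm_supporting_functional[OF assms(2)]
  show "\<exists>(M :: real^'n^'m \<Rightarrow> real) v.
      (\<forall>X. is_max_on (\<lambda>\<Delta>. frobenius_norm (Y - X - \<Delta> X))
        (uncertainty_set lam (schatten_norm p) frobenius_norm) (M X)) \<and>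
      is_min_on M UNIV v \<and>
      is_min_on (\<lambda>X. frobenius_norm (Y - X) + lam * schatten_norm p X) UNIV v"
    \<comment> \<open>The Frobenius norm is the Euclidean \<open>norm\<close> of the matrix type, so
      the comparison constant is 1.\<close>
    by (rule robust_min_max[where c = 1])
      (use assms(1) h in \<open>auto simp: frobenius_norm_eq_norm norm_triangle_ineq\<close>)
  show "\<exists>(M :: real^'n^'m \<Rightarrow> real) v.
      (\<forall>X. is_max_on (\<lambda>\<Delta>. schatten_norm \<infinity> (Y - X - \<Delta> X))
        (uncertainty_set lam (schatten_norm p) (schatten_norm \<infinity>)) (M X)) \<and>
      is_min_on M UNIV v \<and>
      is_min_on (\<lambda>X. schatten_norm \<infinity> (Y - X) + lam * schatten_norm p X) UNIV v"
  proof (rule robust_min_max[where c = "real CARD('m) * real CARD('n)"])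
    fix c :: real and X X' :: "real^'n^'m"
    show "schatten_norm \<infinity> (c *\<^sub>R X) = \<bar>c\<bar> * schatten_norm \<infinity> X"
      using onorm_scaleR[OF matrix_vector_mul_bounded_linear, of c X]
      by (simp add: schatten_norm_infinity_eq_onorm scaleR_matrix_vector_assoc)
    show "schatten_norm \<infinity> (X + X') \<le> schatten_norm \<infinity> X + schatten_norm \<infinity> X'"
      using onorm_triangle[OF matrix_vector_mul_bounded_linear matrix_vector_mul_bounded_linear, of X X']
      by (simp add: schatten_norm_infinity_eq_onorm matrix_vector_mult_add_rdistrib[symmetric])
    show "norm X \<le> real CARD('m) * real CARD('n) * schatten_norm \<infinity> X"
      by (simp only: schatten_norm_infinity_eq_onorm norm_le_onorm_matrix)
  qed (use assms(1) h in auto)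
qed

end
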